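(* Let $M\ge 1$, let $\underline{f}:[a,b]\to\mathbb{R}^M$ be a continuous and rectifiable curve $C$ with graph $[C]=\underline{f}([a,b])$, and let $F:[C]\times\mathbb{R}^M\to\mathbb{R}$ be a parametric integrand. For a partition $P: a=x_0<x_1<\dots<x_n=b$ and points $\xi_i\in[x_{i-1},x_i]$ $(i=1,\dots,n)$, consider the sum $\sum_{i=1}^n F(\underline{f}(\xi_i),\underline{f}(x_i)-\underline{f}(x_{i-1}))$. Then $$\lim_{\|P\|\to 0}\ \sum_{i=1}^n F(\underline{f}(\xi_i),\underline{f}(x_i)-\underline{f}(x_{i-1}))$$ exists and equals $$I(C)=\int_a^b F(\underline{f}(x),\underline{\theta}(x))\,d\mu_C .$$
   Context: $\|\cdot\|$ is the Euclidean norm on $\mathbb{R}^M$; $\|P\|=\max_i(x_i-x_{i-1})$. The length of $C$ is $\ell(C)=\sup_P\sum_i\|\underline{f}(x_i)-\underline{f}(x_{i-1})\|$; $C$ is rectifiable if $\ell(C)<+\infty$. $F$ is a parametric integrand if $F(\underline{x},\underline{t})$ is continuous in $(\underline{x},\underline{t})\in[C]\times\mathbb{R}^M$ and $F(\underline{x},K\underline{t})=KF(\underline{x},\underline{t})$ for all $K\ge 0$. Let $s(x)$ be the length of $\underline{f}|_{[a,x]}$. $\mu_C$ is the Borel measure on $[a,b]$ extending $[c,d]\mapsto s(d)-s(c)$. For $m=1,\dots,M$, $\mu_m^{+},\mu_m^{-}$ are the Borel measures on $[a,b]$ extending $[c,d]\mapsto T^{+}_{f_m}[c,d]$ and $[c,d]\mapsto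 T^{-}_{f_m}[c,d]$ (positive and negative variations of the component $f_m$ on $[c,d]$), $\nu_m=\mu_m^+-\mu_m^-$ (so $\nu_m([c,d])=f_m(d)-f_m(c)$), $\theta_m=d\nu_m/d\mu_C$ is the Radon–Nikodym derivative ($\nu_m$ is absolutely continuous with respect to $\mu_C$), and $\underline{\theta}=(\theta_1,\dots,\theta_M)$. The limit means: for each $\varepsilon>0$ there is $\delta>0$ such that for every $P$ with $\|P\|<\delta$ and every choice of $\xi_i\in[x_{i-1},x_i]$, the sum differs from the limit by less than $\varepsilon$. The integral $I(C)$ exists. *)

theory Defs
  imports "HOL-Analysis.Analysis"
begin

(* A partition a = x 0 < ... < x n = b is represented by n and x; values of x beyond n are
   irrelevant.  The case n = 0 occurs exactly when a = b. *)
definition interval_partition :: "real \<Rightarrow> real \<Rightarrow> nat \<Rightarrow> (nat \<Rightarrow> real) \<Rightarrow> bool" where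
  "interval_partition a b n x \<longleftrightarrow> x 0 = a \<and> x n = b \<and> (\<forall>i<n. x i < x (Suc i))"

definition mesh :: "nat \<Rightarrow> (nat \<Rightarrow> real) \<Rightarrow> real" where
  "mesh n x = Max ((\<lambda>i. x (Suc i) - x i) ` {..<n})"

definition curve_length :: "(real \<Rightarrow> 'a::real_normed_vector) \<Rightarrow> real \<Rightarrow> real \<Rightarrow> ennreal" where
  "curve_length f a b =
     (SUP (n, x) \<in> {(n, x). interval_partition a b n x}.
        ennreal (\<Sum>i<n. norm (f (x (Suc i)) - f (x i))))"

definition rectifiable :: "(real \<Rightarrow> 'a::real_normed_vector) \<Rightarrow> real \<Rightarrow> real \<Rightarrow> bool" where
  "rectifiable f a b \<longleftrightarrow> curve_length f a b < \<infinity>"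

definition pos_variation :: "(real \<Rightarrow> real) \<Rightarrow> real \<Rightarrow> real \<Rightarrow> ennreal" where
  "pos_variation g c d =
     (SUP (n, x) \<in> {(n, x). interval_partition c d n x}.
        ennreal (\<Sum>i<n. max (g (x (Suc i)) - g (x i)) 0))"

definition neg_variation :: "(real \<Rightarrow> real) \<Rightarrow> real \<Rightarrow> real \<Rightarrow> ennreal" where
  "neg_variation g c d =
     (SUP (n, x) \<in> {(n, x). interval_partition c d n x}.
        ennreal (\<Sum>i<n. max (- (g (x (Suc i)) - g (x i))) 0))"

(* The Borel measure on [a,b] whose value on each closed subinterval [c,d] is h c d.
   It is unique when h is finite-valued, because closed intervals form a generating
   intersection-stable family. *)
definition borel_extension :: "real \<Rightarrow> real \<Rightarrow> (real \<Rightarrow> real \<Rightarrow> ennreal) \<Rightarrow> real measure" where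
  "borel_extension a b h =
     (THE \<mu>. sets \<mu> = sets (restrict_space borel {a..b}) \<and>
        (\<forall>c d. a \<le> c \<and> c \<le> d \<and> d \<le> b \<longrightarrow> emeasure \<mu> {c..d} = h c d))"

definition arc_length :: "(real \<Rightarrow> 'a::real_normed_vector) \<Rightarrow> real \<Rightarrow> real \<Rightarrow> real" where
  "arc_length f a x = enn2real (curve_length f a x)"

definition curve_measure :: "(real \<Rightarrow> 'a::real_normed_vector) \<Rightarrow> real \<Rightarrow> real \<Rightarrow> real measure" where
  "curve_measure f a b =
     borel_extension a b (\<lambda>c d. ennreal (arc_length f a d - arc_length f a c))"

definition pos_measure :: "(real \<Rightarrow> real) \<Rightarrow> real \<Rightarrow> real \<Rightarrow> real measure" where
  "pos_measure g a b = borel_extension a b (pos_variation g)"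

definition neg_measure :: "(real \<Rightarrow> real) \<Rightarrow> real \<Rightarrow> real \<Rightarrow> real measure" where
  "neg_measure g a b = borel_extension a b (neg_variation g)"

definition signed_variation_measure :: "(real \<Rightarrow> real) \<Rightarrow> real \<Rightarrow> real \<Rightarrow> real set \<Rightarrow> real" where
  "signed_variation_measure g a b A =
     measure (pos_measure g a b) A - measure (neg_measure g a b) A"

(* The library's RN_deriv covers nonnegative measures only.  Here \<nu> is a finite signed measure
   given as a set function, and \<theta> is any version of its density. *)
definition signed_RN_derivative ::
    "'a measure \<Rightarrow> ('a set \<Rightarrow> real) \<Rightarrow> ('a \<Rightarrow> real) \<Rightarrow> bool" where
  "signed_RN_derivative \<mu> \<nu> \<theta> \<longleftrightarrow>
     integrable \<mu> \<theta> \<and> (\<forall>A\<in>sets \<mu>. (LINT x:A|\<mu>. \<theta> x) = \<nu> A)"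

definition parametric_integrand ::
    "'a set \<Rightarrow> ('a::real_normed_vector \<Rightarrow> 'a \<Rightarrow> real) \<Rightarrow> bool" where
  "parametric_integrand C F \<longleftrightarrow>
     continuous_on (C \<times> UNIV) (\<lambda>(x, t). F x t) \<and>
     (\<forall>x\<in>C. \<forall>t. \<forall>K\<ge>0. F x (K *\<^sub>R t) = K * F x t)"

end

theory Submission
  imports Defs
begin

text \<open>
  The increment of the curve over a partition interval \<open>I = (x\<^sub>i, x\<^sub>i\<^sub>+\<^sub>1]\<close> is the integral
  of \<open>\<theta>\<close> over \<open>I\<close>, because \<open>\<theta>\<close> is the density of the vector measure that the curve induces.
  The mean value of \<open>\<theta>\<close> on \<open>I\<close> is close to \<open>\<theta>\<close> in the \<open>L\<^sup>1\<close> sense once the mesh is small: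
  there are constants \<open>c\<^sub>i\<close> for which \<open>\<Sum>i. \<integral>\<^bsub>I\<^esub> norm (\<theta> - c\<^sub>i)\<close> is as small as desired
  (\<open>integrable_approx_small_sets\<close>), which is a consequence of the regularity of the measure.
  Homogeneity turns \<open>F y c\<^sub>i\<close> times the measure of \<open>I\<close> into \<open>F y\<close> at that multiple of \<open>c\<^sub>i\<close>,
  so both the Riemann term \<open>F (f \<xi>\<^sub>i) (\<integral>\<^bsub>I\<^esub> \<theta>)\<close> and the integral \<open>\<integral>\<^bsub>I\<^esub> F (f x) (\<theta> x)\<close> can be
  compared with it.

  The comparison uses a quantitative form of continuity.  A parametric integrand over a compact set
  satisfies \<open>\<bar>F x s - F y t\<bar> \<le> e * (norm s + norm t) + K * norm (s - t)\<close> for \<open>x\<close> near \<open>y\<close>, with \<open>e\<close>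
  as small as desired and \<open>K\<close> depending on \<open>e\<close> (\<open>parametric_integrand_modulus\<close>).  The error on
  one interval is then at most a multiple of \<open>e\<close> times the integral of \<open>norm \<theta>\<close> plus a multiple of
  \<open>\<integral>\<^bsub>I\<^esub> norm (\<theta> - c\<^sub>i)\<close> (\<open>integrand_local_estimate\<close>), and these errors are summed.

  What remains is to see that the measures exist and have the values on intervals that their
  description promises.  Arc length and the positive and negative variations are all suprema of
  \<open>\<Sum>i. \<phi> (x i) (x (Suc i))\<close> over partitions, for a function \<open>\<phi>\<close> that is subadditive and
  vanishes continuously on the diagonal.  For every such \<open>\<phi>\<close> the supremum is additive over adjacent
  intervals and continuous in its endpoints, and therefore it is a Lebesgue-Stieltjes measure.
\<close>

section \<open>Variation of a subadditive interval function\<close>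

definition variation :: "(real \<Rightarrow> real \<Rightarrow> real) \<Rightarrow> real \<Rightarrow> real \<Rightarrow> ennreal" where
  "variation \<phi> c d =
     (SUP (n, x) \<in> {(n, x). interval_partition c d n x}. ennreal (\<Sum>i<n. \<phi> (x i) (x (Suc i))))"

lemma curve_length_eq_variation: "curve_length f = variation (\<lambda>c d. norm (f d - f c))"
  by (simp add: fun_eq_iff curve_length_def variation_def)

lemma pos_variation_eq_variation: "pos_variation g = variation (\<lambda>c d. max (g d - g c) 0)"
  by (simp add: fun_eq_iff pos_variation_def variation_def)

lemma neg_variation_eq_variation: "neg_variation g = variation (\<lambda>c d. max (- (g d - g c)) 0)"
  by (simp add: fun_eq_iff neg_variation_def variation_def)

lemma variation_upper:
  "interval_partition c d n x \<Longrightarrow> ennreal (\<Sum>i<n. \<phi> (x i) (x (Suc i))) \<le> variation \<phi> c d"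
  unfolding variation_def by (rule SUP_upper2[of "(n, x)"]) auto

lemma variation_least:
  "(\<And>n x. interval_partition c d n x \<Longrightarrow> ennreal (\<Sum>i<n. \<phi> (x i) (x (Suc i))) \<le> C)
    \<Longrightarrow> variation \<phi> c d \<le> C"
  unfolding variation_def by (rule SUP_least) auto

lemma variation_mono:
  assumes "\<And>c d. \<phi> c d \<le> \<psi> c d"
  shows "variation \<phi> c d \<le> variation \<psi> c d"
proof (rule variation_least)
  fix n x assume "interval_partition c d n x"
  then have "ennreal (\<Sum>i<n. \<psi> (x i) (x (Suc i))) \<le> variation \<psi> c d"
    by (rule variation_upper)
  moreover have "ennreal (\<Sum>i<n. \<phi> (x i) (x (Suc i))) \<le> ennreal (\<Sum>i<n. \<psi> (x i) (x (Suc i)))"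
    by (intro ennreal_leI sum_mono assms)
  ultimately show "ennreal (\<Sum>i<n. \<phi> (x i) (x (Suc i))) \<le> variation \<psi> c d"
    by (rule order_trans[rotated])
qed

lemma interval_partition_less:
  assumes "interval_partition c d n x" "i < j" "j \<le> n"
  shows "x i < x j"
  using assms(2,3)
proof (induction j)
  case (Suc j)
  have "x j < x (Suc j)"
    using assms(1) Suc.prems by (auto simp: interval_partition_def)
  moreover have "i = j \<or> x i < x j"
    using Suc by (auto simp: less_Suc_eq)
  ultimately show ?case by auto
qed simp

lemma interval_partition_le:
  assumes "interval_partition c d n x" "i \<le> j" "j \<le> n"
  shows "x i \<le> x j"
  using interval_partition_less[OF assms(1), of i j] assms(2,3) by (cases "i = j") auto

lemma interval_partition_bounds:
  assumes "interval_partition c d n x" "i \<le> n"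
  shows "c \<le> x i" "x i \<le> d"
  using interval_partition_le[OF assms(1), of 0 i] interval_partition_le[OF assms(1), of i n] assms
  by (auto simp: interval_partition_def)

lemma interval_partition_trivial: "interval_partition c c 0 (\<lambda>_. c)"
  by (simp add: interval_partition_def)

lemma interval_partition_single: "c < d \<Longrightarrow> interval_partition c d 1 (\<lambda>i. if i = 0 then c else d)"
  by (simp add: interval_partition_def)

lemma interval_partition_refl_iff: "interval_partition c c n x \<longleftrightarrow> n = 0 \<and> x 0 = c"
proof
  assume *: "interval_partition c c n x"
  with interval_partition_less[OF *, of 0 n] show "n = 0 \<and> x 0 = c"
    by (cases "n = 0") (auto simp: interval_partition_def)
qed (auto simp: interval_partition_def)

lemma interval_partition_butlast:
  "interval_partition c d (Suc n) x \<Longrightarrow> interval_partition c (x n) n x"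
  by (simp add: interval_partition_def)

lemma interval_partition_tl:
  "interval_partition c d (Suc n) x \<Longrightarrow> interval_partition (x 1) d n (\<lambda>i. x (Suc i))"
  by (simp add: interval_partition_def)

lemma interval_partition_snoc:
  "interval_partition c d n x \<Longrightarrow> d < e \<Longrightarrow> interval_partition c e (Suc n) (x(Suc n := e))"
  by (auto simp: interval_partition_def)

text \<open>The only partition of a degenerate interval has no subintervals.\<close>
lemma variation_refl [simp]: "variation \<phi> c c = 0"
proof -
  have "variation \<phi> c c \<le> 0"
    by (rule variation_least) (auto simp: interval_partition_refl_iff)
  then show ?thesis by simp
qed

lemma variation_snoc:
  assumes "c \<le> d" "d < e" "\<And>c d. 0 \<le> \<phi> c d"
  shows "variation \<phi> c d + ennreal (\<phi> d e) \<le> variation \<phi> c e"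
proof -
  have ne: "{(n, x). interval_partition c d n x} \<noteq> {}"
    using interval_partition_single[of c d] interval_partition_trivial[of c] assms(1)
    by (cases "c = d") auto
  show ?thesis
    unfolding variation_def[of _ c d]
    unfolding ennreal_SUP_add_left[OF ne, symmetric]
  proof (rule SUP_least, clarify)
    fix n x assume P: "interval_partition c d n x"
    from variation_upper[OF interval_partition_snoc[OF P assms(2)], of \<phi>] P
    have "ennreal ((\<Sum>i<n. \<phi> (x i) (x (Suc i))) + \<phi> d e) \<le> variation \<phi> c e"
      by (simp add: interval_partition_def)
    then show "ennreal (\<Sum>i<n. \<phi> (x i) (x (Suc i))) + ennreal (\<phi> d e) \<le> variation \<phi> c e"
      using assms by (subst ennreal_plus[symmetric]) (auto intro!: sum_nonneg)
  qed
qed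

text \<open>The common properties of \<open>norm (f d - f c)\<close> and of the positive and negative parts of
  \<open>g d - g c\<close> that make their variation an atomless measure.\<close>
locale interval_functional =
  fixes a b :: real and \<phi> :: "real \<Rightarrow> real \<Rightarrow> real"
  assumes ab: "a \<le> b"
    and nonneg: "\<And>c d. 0 \<le> \<phi> c d"
    and diag: "\<And>c. \<phi> c c = 0"
    and triangle: "\<And>c d e. \<phi> c e \<le> \<phi> c d + \<phi> d e"
    and cont_right: "\<And>c. c \<in> {a..b} \<Longrightarrow> ((\<lambda>d. \<phi> c d) \<longlongrightarrow> 0) (at c within {a..b})"
    and cont_left: "\<And>d. d \<in> {a..b} \<Longrightarrow> ((\<lambda>c. \<phi> c d) \<longlongrightarrow> 0) (at d within {a..b})"
    and finite: "variation \<phi> a b < \<infinity>"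
begin

lemma le_variation: "c \<le> d \<Longrightarrow> ennreal (\<phi> c d) \<le> variation \<phi> c d"
  using variation_upper[OF interval_partition_single, of c d \<phi>]
  by (cases "c = d") (auto simp: diag)

lemma snoc: "c \<le> d \<Longrightarrow> d \<le> e \<Longrightarrow> variation \<phi> c d + ennreal (\<phi> d e) \<le> variation \<phi> c e"
  using variation_snoc[of c d e \<phi>] nonneg by (cases "d = e") (auto simp: diag)

text \<open>Appending the points of a partition of the second interval one at a time avoids
  concatenating index functions.\<close>
lemma superadditive:
  assumes "c \<le> d" "d \<le> e"
  shows "variation \<phi> c d + variation \<phi> d e \<le> variation \<phi> c e"
proof -
  have ne: "{(n, x). interval_partition d e n x} \<noteq> {}"
    using interval_partition_single[of d e] interval_partition_trivial[of d] assms(2)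
    by (cases "d = e") auto
  have *: "variation \<phi> c d + ennreal (\<Sum>i<n. \<phi> (x i) (x (Suc i))) \<le> variation \<phi> c e"
    if "interval_partition d e n x" for n e x
    using that
  proof (induction n arbitrary: e)
    case 0
    then have "e = d" by (simp add: interval_partition_def)
    then show ?case by simp
  next
    case (Suc n)
    have e: "e = x (Suc n)" and le: "d \<le> x n" "x n \<le> e"
      using Suc.prems interval_partition_bounds[OF Suc.prems, of n] by (auto simp: interval_partition_def)
    have "variation \<phi> c d + ennreal (\<Sum>i<Suc n. \<phi> (x i) (x (Suc i))) =
        (variation \<phi> c d + ennreal (\<Sum>i<n. \<phi> (x i) (x (Suc i)))) + ennreal (\<phi> (x n) e)"
      by (simp add: e add.assoc sum_nonneg nonneg)
    also have "\<dots> \<le> variation \<phi> c (x n) + ennreal (\<phi> (x n) e)"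
      by (intro add_right_mono Suc.IH interval_partition_butlast[OF Suc.prems])
    also have "\<dots> \<le> variation \<phi> c e"
      using le assms by (intro snoc) auto
    finally show ?case .
  qed
  show ?thesis
    unfolding variation_def[of _ d e]
    by (subst add.commute, subst ennreal_SUP_add_left[OF ne, symmetric])
      (auto intro!: SUP_least * simp: add.commute[of _ "variation \<phi> c d"])
qed

text \<open>For the nontrivial inequality, a partition of the whole interval is split at \<open>d\<close>; the
  triangle inequality pays for the subinterval that \<open>d\<close> cuts. The induction peels off the last
  subinterval, which contains \<open>d\<close> or lies to the right of it.\<close>
lemma additive:
  assumes "c \<le> d" "d \<le> e"
  shows "variation \<phi> c e = variation \<phi> c d + variation \<phi> d e"
proof (rule antisym)
  have "ennreal (\<Sum>i<n. \<phi> (x i) (x (Suc i))) \<le> variation \<phi> c d + variation \<phi> d e"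
    if "interval_partition c e n x" "c \<le> d" "d \<le> e" for n x c d e
    using that
  proof (induction n arbitrary: e d)
    case 0
    then show ?case by simp
  next
    case (Suc n)
    have e: "e = x (Suc n)" and le: "c \<le> x n" "x n \<le> e"
      using Suc.prems interval_partition_bounds[OF Suc.prems(1), of n]
      by (auto simp: interval_partition_def)
    note P = interval_partition_butlast[OF Suc.prems(1)]
    have eq: "ennreal (\<Sum>i<Suc n. \<phi> (x i) (x (Suc i))) =
        ennreal (\<Sum>i<n. \<phi> (x i) (x (Suc i))) + ennreal (\<phi> (x n) e)"
      by (simp add: e sum_nonneg nonneg)
    show ?case
    proof (cases "x n \<le> d")
      case True
      have "ennreal (\<phi> (x n) e) \<le> ennreal (\<phi> (x n) d) + ennreal (\<phi> d e)"
        using triangle nonneg by (simp flip: ennreal_plus add: ennreal_leI)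
      then have "ennreal (\<Sum>i<Suc n. \<phi> (x i) (x (Suc i))) \<le>
          variation \<phi> c (x n) + (ennreal (\<phi> (x n) d) + ennreal (\<phi> d e))"
        unfolding eq by (intro add_mono variation_upper P)
      also have "\<dots> = (variation \<phi> c (x n) + ennreal (\<phi> (x n) d)) + ennreal (\<phi> d e)"
        by (simp add: add.assoc)
      also have "\<dots> \<le> variation \<phi> c d + variation \<phi> d e"
        using True le Suc.prems by (intro add_mono snoc le_variation) auto
      finally show ?thesis .
    next
      case False
      have "ennreal (\<Sum>i<Suc n. \<phi> (x i) (x (Suc i))) \<le>
          (variation \<phi> c d + variation \<phi> d (x n)) + ennreal (\<phi> (x n) e)"
        unfolding eq using False Suc.prems by (intro add_right_mono Suc.IH[OF P]) auto
      also have "\<dots> = variation \<phi> c d + (variation \<phi> d (x n) + ennreal (\<phi> (x n) e))"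
        by (simp add: add.assoc)
      also have "\<dots> \<le> variation \<phi> c d + variation \<phi> d e"
        using False le by (intro add_left_mono snoc) auto
      finally show ?thesis .
    qed
  qed
  then show "variation \<phi> c e \<le> variation \<phi> c d + variation \<phi> d e"
    using assms by (intro variation_least) auto
qed (rule superadditive[OF assms])

lemma finite_sub:
  assumes "a \<le> c" "c \<le> d" "d \<le> b"
  shows "variation \<phi> c d < \<infinity>"
proof -
  have "variation \<phi> a b = variation \<phi> a c + (variation \<phi> c d + variation \<phi> d b)"
    using assms by (simp add: additive[of a c b] additive[of c d b])
  with finite show ?thesis by (auto simp: less_top)
qed

definition accum :: "real \<Rightarrow> real" where "accum x = enn2real (variation \<phi> a x)"

lemma variation_eq_accum:
  assumes "a \<le> c" "c \<le> d" "d \<le> b"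
  shows "variation \<phi> c d = ennreal (accum d - accum c)" and "accum c \<le> accum d"
proof -
  have fin: "variation \<phi> a c < \<infinity>" "variation \<phi> c d < \<infinity>"
    using assms finite_sub[of a c] finite_sub[of c d] by auto
  have "accum d = accum c + enn2real (variation \<phi> c d)"
    unfolding accum_def additive[OF assms(1,2)] using fin by (simp add: enn2real_plus)
  with fin show "variation \<phi> c d = ennreal (accum d - accum c)" "accum c \<le> accum d"
    by auto
qed

text \<open>Fix a partition of \<open>[c, b]\<close> that is optimal up to \<open>e\<close>, and insert a point \<open>d\<close> into its first
  subinterval. The part of the refined sum over \<open>[d, b]\<close> is at most the variation there, so by
  additivity the variation of \<open>[c, d]\<close> exceeds the single term \<open>\<phi> c d\<close> by at most \<open>e\<close>.\<close>
lemma right_small: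
  assumes "a \<le> c" "c < b" "0 < e"
  shows "\<exists>y>c. \<forall>d. c < d \<and> d < y \<and> d \<le> b \<longrightarrow> accum d - accum c \<le> \<phi> c d + e"
proof -
  have v: "variation \<phi> c b = ennreal (accum b - accum c)" "accum c \<le> accum b"
    using variation_eq_accum[of c b] assms by auto
  have "\<exists>n x. interval_partition c b n x \<and> accum b - accum c - e < (\<Sum>i<n. \<phi> (x i) (x (Suc i)))"
  proof (rule ccontr)
    assume no: "\<not> ?thesis"
    then have "variation \<phi> c b \<le> ennreal (accum b - accum c - e)"
      by (intro variation_least ennreal_leI) (auto simp: not_less)
    moreover have "0 \<le> accum b - accum c - e"
      using no interval_partition_single[of c b] assms nonneg[of c b]
      by (force simp: not_less)
    ultimately show False using v assms by simp
  qed
  then obtain n x where P: "interval_partition c b n x"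
    and S: "accum b - accum c - e < (\<Sum>i<n. \<phi> (x i) (x (Suc i)))" by auto
  then obtain m where n: "n = Suc m"
    using assms by (cases n) (auto simp: interval_partition_def)
  have x: "x 0 = c" "c < x 1" "x 1 \<le> b"
    using P interval_partition_bounds[OF P, of 1] by (auto simp: n interval_partition_def)
  have "accum d - accum c \<le> \<phi> c d + e" if d: "c < d" "d < x 1" "d \<le> b" for d
  proof -
    have "ennreal (\<Sum>i<m. \<phi> (x (Suc i)) (x (Suc (Suc i)))) \<le> variation \<phi> (x 1) b"
      using variation_upper[OF interval_partition_tl[OF P[unfolded n]], of \<phi>] by simp
    then have 1: "(\<Sum>i<m. \<phi> (x (Suc i)) (x (Suc (Suc i)))) \<le> accum b - accum (x 1)"
      using variation_eq_accum[of "x 1" b] x assms by simp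
    have 2: "\<phi> d (x 1) \<le> accum (x 1) - accum d"
      using le_variation[of d "x 1"] variation_eq_accum[of d "x 1"] d x assms by simp
    have "(\<Sum>i<n. \<phi> (x i) (x (Suc i))) = \<phi> c (x 1) + (\<Sum>i<m. \<phi> (x (Suc i)) (x (Suc (Suc i))))"
      unfolding n by (subst sum.lessThan_Suc_shift) (simp add: x)
    with 1 2 S triangle[of c "x 1" d] show ?thesis by linarith
  qed
  with x show ?thesis by (intro exI[of _ "x 1"]) auto
qed

text \<open>The mirror image, with the last subinterval of a nearly optimal partition of \<open>[a, c]\<close>.\<close>
lemma left_small:
  assumes "a < c" "c \<le> b" "0 < e"
  shows "\<exists>y<c. \<forall>d. y < d \<and> d < c \<and> a \<le> d \<longrightarrow> accum c - accum d \<le> \<phi> d c + e"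
proof -
  have v: "variation \<phi> a c = ennreal (accum c - accum a)" "accum a \<le> accum c"
    using variation_eq_accum[of a c] assms by auto
  have "\<exists>n x. interval_partition a c n x \<and> accum c - accum a - e < (\<Sum>i<n. \<phi> (x i) (x (Suc i)))"
  proof (rule ccontr)
    assume no: "\<not> ?thesis"
    then have "variation \<phi> a c \<le> ennreal (accum c - accum a - e)"
      by (intro variation_least ennreal_leI) (auto simp: not_less)
    moreover have "0 \<le> accum c - accum a - e"
      using no interval_partition_single[of a c] assms nonneg[of a c]
      by (force simp: not_less)
    ultimately show False using v assms by simp
  qed
  then obtain n x where P: "interval_partition a c n x"
    and S: "accum c - accum a - e < (\<Sum>i<n. \<phi> (x i) (x (Suc i)))" by auto
  then obtain m where n: "n = Suc m"
    using assms by (cases n) (auto simp: interval_partition_def)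
  have x: "x n = c" "x m < c" "a \<le> x m"
    using P interval_partition_bounds[OF P, of m] by (auto simp: n interval_partition_def)
  have "accum c - accum d \<le> \<phi> d c + e" if d: "x m < d" "d < c" "a \<le> d" for d
  proof -
    have "ennreal (\<Sum>i<m. \<phi> (x i) (x (Suc i))) \<le> variation \<phi> a (x m)"
      using variation_upper[OF interval_partition_butlast[OF P[unfolded n]], of \<phi>] by simp
    then have 1: "(\<Sum>i<m. \<phi> (x i) (x (Suc i))) \<le> accum (x m) - accum a"
      using variation_eq_accum[of a "x m"] x assms by simp
    have 2: "\<phi> (x m) d \<le> accum d - accum (x m)"
      using le_variation[of "x m" d] variation_eq_accum[of "x m" d] d x assms by simp
    have "(\<Sum>i<n. \<phi> (x i) (x (Suc i))) = (\<Sum>i<m. \<phi> (x i) (x (Suc i))) + \<phi> (x m) c"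
      using x unfolding n by simp
    with 1 2 S triangle[of "x m" c d] show ?thesis by linarith
  qed
  with x show ?thesis by (intro exI[of _ "x m"]) auto
qed

lemma continuous_on_accum: "continuous_on {a..b} accum"
  unfolding continuous_on_def
proof
  fix c assume c: "c \<in> {a..b}"
  show "(accum \<longlongrightarrow> accum c) (at c within {a..b})"
  proof (rule tendstoI)
    fix e :: real assume e: "0 < e"
    have "0 < e/2" using e by simp
    have ev1: "\<forall>\<^sub>F d in at c within {a..b}. \<phi> c d < e/2"
      using cont_right[OF c] \<open>0 < e/2\<close> by (rule order_tendstoD(2))
    have ev2: "\<forall>\<^sub>F d in at c within {a..b}. \<phi> d c < e/2"
      using cont_left[OF c] \<open>0 < e/2\<close> by (rule order_tendstoD(2))
    have ev3: "\<forall>\<^sub>F d in at c within {a..b}. c < d \<longrightarrow> accum d - accum c \<le> \<phi> c d + e/2"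
    proof (cases "c < b")
      case True
      then obtain y where "c < y" "\<And>d. c < d \<Longrightarrow> d < y \<Longrightarrow> d \<le> b \<Longrightarrow> accum d - accum c \<le> \<phi> c d + e/2"
        using right_small[of c "e/2"] c e by auto
      then show ?thesis
        unfolding eventually_at_topological
        by (intro exI[of _ "{..<y}"]) auto
    qed (use c in \<open>auto simp: eventually_at_filter\<close>)
    have ev4: "\<forall>\<^sub>F d in at c within {a..b}. d < c \<longrightarrow> accum c - accum d \<le> \<phi> d c + e/2"
    proof (cases "a < c")
      case True
      then obtain y where "y < c" "\<And>d. y < d \<Longrightarrow> d < c \<Longrightarrow> a \<le> d \<Longrightarrow> accum c - accum d \<le> \<phi> d c + e/2"
        using left_small[of c "e/2"] c e by auto
      then show ?thesis
        unfolding eventually_at_topological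
        by (intro exI[of _ "{y<..}"]) auto
    qed (use c in \<open>auto simp: eventually_at_filter\<close>)
    have "\<forall>\<^sub>F d in at c within {a..b}. d \<in> {a..b} \<and> d \<noteq> c"
      by (simp add: eventually_at_filter)
    then show "\<forall>\<^sub>F d in at c within {a..b}. dist (accum d) (accum c) < e"
      using ev1 ev2 ev3 ev4
    proof eventually_elim
      case (elim d)
      then show ?case
        using variation_eq_accum(2)[of c d] variation_eq_accum(2)[of d c] c
        by (cases "c < d") (auto simp: dist_real_def)
    qed
  qed
qed

text \<open>The restriction to \<open>[a, b]\<close> of the Lebesgue-Stieltjes measure of \<open>accum\<close>, continued by
  constants outside of \<open>[a, b]\<close>.\<close>
lemma ex_measure:
  "\<exists>\<mu>. sets \<mu> = sets (restrict_space borel {a..b}) \<and>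
     (\<forall>c d. a \<le> c \<and> c \<le> d \<and> d \<le> b \<longrightarrow> emeasure \<mu> {c..d} = variation \<phi> c d)"
proof -
  define S where "S x = accum (max a (min b x))" for x
  have mono: "S x \<le> S y" if "x \<le> y" for x y
    unfolding S_def using that ab by (intro variation_eq_accum) auto
  have cont: "continuous_on UNIV S"
    unfolding S_def using ab
    by (intro continuous_on_compose2[OF continuous_on_accum] continuous_intros) auto
  have "emeasure (restrict_space (interval_measure S) {a..b}) {c..d} = variation \<phi> c d"
    if "a \<le> c" "c \<le> d" "d \<le> b" for c d
  proof -
    have "emeasure (restrict_space (interval_measure S) {a..b}) {c..d} = emeasure (interval_measure S) {c..d}"
      using that by (intro emeasure_restrict_space) auto
    also have "\<dots> = S d - S c"
      using that by (intro emeasure_interval_measure_Icc mono cont) auto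
    also have "\<dots> = variation \<phi> c d"
      using that by (simp add: S_def variation_eq_accum)
    finally show ?thesis .
  qed
  then show ?thesis
    by (intro exI[of _ "restrict_space (interval_measure S) {a..b}"])
      (simp add: sets_restrict_space)
qed

end

section \<open>The measures of the curve\<close>

text \<open>Both measures are pushed forward to the whole line, where closed intervals generate the Borel
  sets.\<close>
lemma borel_extension_unique:
  fixes a b :: real
  assumes \<mu>: "sets \<mu> = sets (restrict_space borel {a..b})"
    and \<nu>: "sets \<nu> = sets (restrict_space borel {a..b})"
    and eq: "\<And>c d. a \<le> c \<Longrightarrow> c \<le> d \<Longrightarrow> d \<le> b \<Longrightarrow> emeasure \<mu> {c..d} = emeasure \<nu> {c..d}"
    and fin: "emeasure \<mu> {a..b} < \<infinity>"
  shows "\<mu> = \<nu>"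
proof -
  have id: "(\<lambda>x. x) \<in> measurable \<mu> borel" "(\<lambda>x. x) \<in> measurable \<nu> borel"
    unfolding measurable_cong_sets[OF \<mu> refl] measurable_cong_sets[OF \<nu> refl]
    by (auto intro: measurable_restrict_space1)
  have sp: "space \<mu> = {a..b}" "space \<nu> = {a..b}"
    using sets_eq_imp_space_eq[OF \<mu>] sets_eq_imp_space_eq[OF \<nu>] by (simp_all add: space_restrict_space)
  have Icc: "emeasure \<mu> ({c..d} \<inter> {a..b}) = emeasure \<nu> ({c..d} \<inter> {a..b})" for c d
    using eq[of "max c a" "min d b"] by (cases "max c a \<le> min d b") (auto simp: Int_atLeastAtMost)
  have "distr \<mu> borel (\<lambda>x. x) = distr \<nu> borel (\<lambda>x. x)"
  proof (rule measure_eqI_generator_eq[where E="range (\<lambda>(c,d). {c..d::real})" and \<Omega>=UNIV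
        and A="\<lambda>i. {-real i..real i}"])
    show "Int_stable (range (\<lambda>(c,d). {c..d::real}))"
      by (auto simp: Int_stable_def Int_atLeastAtMost)
    show "emeasure (distr \<mu> borel (\<lambda>x. x)) X = emeasure (distr \<nu> borel (\<lambda>x. x)) X"
      if "X \<in> range (\<lambda>(c,d). {c..d::real})" for X
      using that Icc by (auto simp: emeasure_distr id sp)
    show "(\<Union>i. {-real i..real i}) = UNIV"
      by (auto simp: abs_le_iff[symmetric]) (metis abs_le_iff real_arch_simple minus_le_iff)
    show "emeasure (distr \<mu> borel (\<lambda>x. x)) {-real i..real i} \<noteq> \<infinity>" for i
    proof -
      have "emeasure (distr \<mu> borel (\<lambda>x. x)) {-real i..real i} \<le> emeasure \<mu> {a..b}"
        by (subst emeasure_distr[OF id(1)]) (auto intro!: emeasure_mono simp: sp sets.top[of \<mu>, unfolded sp])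
      with fin show ?thesis by auto
    qed
  qed (auto simp: borel_eq_atLeastAtMost)
  note * = this
  show ?thesis
  proof (rule measure_eqI)
    fix A assume A: "A \<in> sets \<mu>"
    then have "A \<in> sets borel" "A \<subseteq> {a..b}"
      by (auto simp: \<mu> sets_restrict_space)
    then show "emeasure \<mu> A = emeasure \<nu> A"
      using arg_cong[OF *, of "\<lambda>M. emeasure M A"] by (simp add: emeasure_distr id sp Int_absorb2)
  qed (simp add: \<mu> \<nu>)
qed

context interval_functional
begin

text \<open>The function \<open>h\<close> is compared with the variation only for \<open>a \<le> c \<le> d \<le> b\<close>, since a
  difference of arc lengths and the variation disagree in general outside of \<open>[a, b]\<close>.\<close>
lemma borel_extension:
  assumes h: "\<And>c d. a \<le> c \<Longrightarrow> c \<le> d \<Longrightarrow> d \<le> b \<Longrightarrow> h c d = variation \<phi> c d"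
  shows "sets (borel_extension a b h) = sets (restrict_space borel {a..b})" (is ?A)
    and "\<And>c d. a \<le> c \<Longrightarrow> c \<le> d \<Longrightarrow> d \<le> b \<Longrightarrow> emeasure (borel_extension a b h) {c..d} = variation \<phi> c d"
proof -
  let ?P = "\<lambda>\<mu>. sets \<mu> = sets (restrict_space borel {a..b}) \<and>
        (\<forall>c d. a \<le> c \<and> c \<le> d \<and> d \<le> b \<longrightarrow> emeasure \<mu> {c..d} = h c d)"
  obtain \<mu> where \<mu>: "?P \<mu>" using ex_measure h by auto
  have "?P (borel_extension a b h)"
    unfolding borel_extension_def
  proof (rule theI)
    show "?P \<mu>" by fact
    show "\<nu> = \<mu>" if "?P \<nu>" for \<nu>
      using that \<mu> ab finite h[of a b] by (intro borel_extension_unique[of \<nu> a b \<mu>]) auto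
  qed
  then show ?A "\<And>c d. a \<le> c \<Longrightarrow> c \<le> d \<Longrightarrow> d \<le> b \<Longrightarrow> emeasure (borel_extension a b h) {c..d} = variation \<phi> c d"
    using h by auto
qed

end

text \<open>Being dominated by the oscillation of a continuous rectifiable curve yields both the continuity
  on the diagonal and the finiteness of the variation.\<close>
lemma interval_functionalI:
  fixes f :: "real \<Rightarrow> 'a::real_normed_vector"
  assumes "a \<le> b" and f: "continuous_on {a..b} f" and "rectifiable f a b"
    and "\<And>c d. 0 \<le> \<phi> c d" and le: "\<And>c d. \<phi> c d \<le> norm (f d - f c)"
    and "\<And>c d e. \<phi> c e \<le> \<phi> c d + \<phi> d e"
  shows "interval_functional a b \<phi>"
proof
  show "\<phi> c c = 0" for c
    using le[of c c] assms(4)[of c c] by simp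
  have lim: "((\<lambda>d. norm (f d - f c)) \<longlongrightarrow> 0) (at c within {a..b})" if "c \<in> {a..b}" for c
    using f that by (auto simp: continuous_on_def intro!: tendsto_norm_zero LIM_zero)
  show "((\<lambda>d. \<phi> c d) \<longlongrightarrow> 0) (at c within {a..b})" if "c \<in> {a..b}" for c
    by (rule tendsto_sandwich[OF _ _ tendsto_const lim[OF that]])
      (use assms in \<open>auto intro!: always_eventually\<close>)
  show "((\<lambda>d. \<phi> d c) \<longlongrightarrow> 0) (at c within {a..b})" if "c \<in> {a..b}" for c
    by (rule tendsto_sandwich[OF _ _ tendsto_const lim[OF that]])
      (use assms(4) le[of _ c] in \<open>auto intro!: always_eventually simp: norm_minus_commute[of _ "f c"]\<close>)
  have "variation \<phi> a b \<le> curve_length f a b"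
    unfolding curve_length_eq_variation by (intro variation_mono le)
  then show "variation \<phi> a b < \<infinity>"
    using assms(3) by (auto simp: rectifiable_def)
qed (use assms in auto)

lemma curve_measure:
  fixes f :: "real \<Rightarrow> 'a::real_normed_vector"
  assumes "a \<le> b" "continuous_on {a..b} f" "rectifiable f a b"
  shows sets_curve_measure: "sets (curve_measure f a b) = sets (restrict_space borel {a..b})"
    and emeasure_curve_measure:
      "\<And>c d. a \<le> c \<Longrightarrow> c \<le> d \<Longrightarrow> d \<le> b \<Longrightarrow> emeasure (curve_measure f a b) {c..d} = curve_length f c d"
proof -
  interpret interval_functional a b "\<lambda>c d. norm (f d - f c)"
  proof (rule interval_functionalI[OF assms])
    show "norm (f e - f c) \<le> norm (f d - f c) + norm (f e - f d)" for c d e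
      using norm_triangle_ineq[of "f d - f c" "f e - f d"] by simp
  qed auto
  have "ennreal (arc_length f a d - arc_length f a c) = variation (\<lambda>c d. norm (f d - f c)) c d"
    if "a \<le> c" "c \<le> d" "d \<le> b" for c d
    using variation_eq_accum(1)[OF that] by (simp add: arc_length_def accum_def curve_length_eq_variation)
  from borel_extension[of "\<lambda>c d. ennreal (arc_length f a d - arc_length f a c)", OF this]
  show "sets (curve_measure f a b) = sets (restrict_space borel {a..b})"
    "\<And>c d. a \<le> c \<Longrightarrow> c \<le> d \<Longrightarrow> d \<le> b \<Longrightarrow> emeasure (curve_measure f a b) {c..d} = curve_length f c d"
    by (simp_all add: curve_measure_def curve_length_eq_variation)
qed

text \<open>On each partition the sum of the positive parts exceeds that of the negative parts by the total
  increment of \<open>g\<close>; this constant shift passes to the suprema.\<close>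
lemma signed_variation_measure_Icc:
  fixes f :: "real \<Rightarrow> 'a::real_normed_vector"
  assumes "a \<le> b" "continuous_on {a..b} f" "rectifiable f a b"
    and g: "\<And>c d. \<bar>g d - g c\<bar> \<le> norm (f d - f c)"
    and cd: "a \<le> c" "c \<le> d" "d \<le> b"
  shows "signed_variation_measure g a b {c..d} = g d - g c"
proof -
  let ?p = "\<lambda>c d. max (g d - g c) 0" and ?n = "\<lambda>c d. max (- (g d - g c)) 0"
  have le: "?p c d \<le> norm (f d - f c)" "?n c d \<le> norm (f d - f c)" for c d
    using g[where c=c and d=d] by auto
  interpret pos: interval_functional a b ?p
    using assms(1-3) _ le(1) by (rule interval_functionalI) auto
  interpret neg: interval_functional a b ?n
    using assms(1-3) _ le(2) by (rule interval_functionalI) auto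
  define P N where "P = enn2real (variation ?p c d)" and "N = enn2real (variation ?n c d)"
  have PN: "variation ?p c d = ennreal P" "variation ?n c d = ennreal N" "0 \<le> P" "0 \<le> N"
    using pos.finite_sub[OF cd] neg.finite_sub[OF cd] by (auto simp: P_def N_def)
  have jordan: "(\<Sum>i<n. ?p (x i) (x (Suc i))) = g d - g c + (\<Sum>i<n. ?n (x i) (x (Suc i)))"
    if "interval_partition c d n x" for n x
  proof -
    have "(\<Sum>i<n. ?p (x i) (x (Suc i))) - (\<Sum>i<n. ?n (x i) (x (Suc i)))
        = (\<Sum>i<n. g (x (Suc i)) - g (x i))"
      unfolding sum_subtractf[symmetric] by (intro sum.cong) auto
    also have "\<dots> = g d - g c"
      using that sum_lessThan_telescope[of "\<lambda>i. g (x i)" n] by (simp add: interval_partition_def)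
    finally show ?thesis by simp
  qed
  have up: "(\<Sum>i<n. ?p (x i) (x (Suc i))) \<le> P" "(\<Sum>i<n. ?n (x i) (x (Suc i))) \<le> N"
    if "interval_partition c d n x" for n x
    using variation_upper[OF that, of ?p] variation_upper[OF that, of ?n] PN by auto
  have "\<exists>n x. interval_partition c d n x"
    using cd interval_partition_single[of c d] interval_partition_trivial[of c]
    by (cases "c = d") auto
  then have "0 \<le> g d - g c + N" "0 \<le> P - (g d - g c)"
    using jordan up by (smt (verit, best) sum_nonneg max.cobounded2)+
  moreover have "variation ?p c d \<le> ennreal (g d - g c + N)"
    using jordan up by (intro variation_least ennreal_leI) fastforce
  moreover have "variation ?n c d \<le> ennreal (P - (g d - g c))"
    using jordan up by (intro variation_least ennreal_leI) fastforce
  ultimately have "P - N = g d - g c"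
    unfolding PN by simp
  then show ?thesis
    using pos.borel_extension(2)[of "pos_variation g", OF _ cd]
      neg.borel_extension(2)[of "neg_variation g", OF _ cd]
    by (simp add: signed_variation_measure_def pos_measure_def neg_measure_def measure_def
        pos_variation_eq_variation neg_variation_eq_variation P_def N_def)
qed

section \<open>Approximation in mean by constants on small sets\<close>

lemma integrable_imp_set_integrable:
  fixes h :: "'a \<Rightarrow> 'b::{banach, second_countable_topology}"
  shows "integrable M h \<Longrightarrow> A \<in> sets M \<Longrightarrow> set_integrable M A h"
  unfolding set_integrable_def by (rule integrable_mult_indicator)

lemma sum_set_integral_le:
  fixes h :: "'a \<Rightarrow> real"
  assumes "integrable M h" "\<And>x. 0 \<le> h x" "finite J" "disjoint_family_on I J" "\<And>j. j \<in> J \<Longrightarrow> I j \<in> sets M"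
  shows "(\<Sum>j\<in>J. LINT x:I j|M. h x) \<le> (LINT x|M. h x)"
proof -
  have int: "set_integrable M (I j) h" if "j \<in> J" for j
    using assms that by (intro integrable_imp_set_integrable) auto
  have "(\<Sum>j\<in>J. LINT x:I j|M. h x) = (LINT x:(\<Union>j\<in>J. I j)|M. h x)"
    using assms int by (intro set_integral_finite_Union[symmetric]) auto
  also have "\<dots> \<le> (LINT x|M. h x)"
    unfolding set_lebesgue_integral_def
    using assms by (intro integral_mono integrable_mult_indicator sets.finite_UN) (auto simp: indicator_def)
  finally show ?thesis .
qed

text \<open>Inner and outer regularity on the whole space, applied to the pushforward of \<open>M\<close> under the
  inclusion of \<open>S\<close>.\<close>
lemma finite_measure_regular:
  fixes S :: "'a::{second_countable_topology, complete_space} set"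
  assumes "finite_measure M" and M: "sets M = sets (restrict_space borel S)" and S: "S \<in> sets borel"
    and A: "A \<in> sets M" and "0 < e"
  shows "\<exists>K U. compact K \<and> open U \<and> K \<subseteq> A \<and> A \<subseteq> U \<and> measure M ((U - K) \<inter> S) < e"
proof -
  interpret finite_measure M by fact
  have id: "(\<lambda>x. x) \<in> measurable M borel"
    unfolding measurable_cong_sets[OF M refl] by (auto intro: measurable_restrict_space1)
  have sp: "space M = S"
    using sets_eq_imp_space_eq[OF M] by (simp add: space_restrict_space)
  define N where "N = distr M borel (\<lambda>x. x)"
  have N: "emeasure N B = emeasure M (B \<inter> S)" if "B \<in> sets borel" for B
    using that by (simp add: N_def emeasure_distr id sp)
  have N_sets: "sets N = sets borel" by (simp add: N_def)
  interpret N: finite_measure N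
    unfolding N_def by (rule finite_measure_distr[OF id])
  have fin: "emeasure N (space N) \<noteq> \<infinity>" by simp
  have A': "A \<in> sets borel" "A \<subseteq> S"
    using A S by (auto simp: M sets_restrict_space)
  have "\<exists>K\<in>{K. K \<subseteq> A \<and> compact K}. emeasure N A < emeasure N K + ennreal (e/2)"
  proof (cases "emeasure N A < ennreal (e/2)")
    case True
    then show ?thesis by (intro bexI[of _ "{}"]) auto
  next
    case False
    have "emeasure N A - ennreal (e/2) < emeasure N A"
      using False \<open>0 < e\<close> N.emeasure_finite[of A]
      by (intro ennreal_between) (auto simp: not_less less_top[symmetric] intro: less_le_trans[rotated])
    then obtain K where "K \<subseteq> A" "compact K" "emeasure N A - ennreal (e/2) < emeasure N K"
      unfolding inner_regular[OF N_sets fin A'(1)] less_SUP_iff by auto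
    then show ?thesis
      using False \<open>0 < e\<close>
      by (intro bexI[of _ K])
        (auto simp: not_less N.emeasure_eq_measure ennreal_minus ennreal_less_iff simp flip: ennreal_plus)
  qed
  then obtain K where K: "K \<subseteq> A" "compact K" "measure N A < measure N K + e/2"
    using \<open>0 < e\<close> by (auto simp: N.emeasure_eq_measure ennreal_less_iff simp flip: ennreal_plus)
  have "emeasure N A < emeasure N A + ennreal (e/2)"
    using \<open>0 < e\<close> by (simp add: N.emeasure_eq_measure ennreal_less_iff flip: ennreal_plus)
  then obtain U where U: "A \<subseteq> U" "open U" "emeasure N U < emeasure N A + ennreal (e/2)"
    unfolding outer_regular[OF N_sets fin A'(1)] INF_less_iff by auto
  then have U': "measure N U < measure N A + e/2"
    using \<open>0 < e\<close> by (simp add: N.emeasure_eq_measure ennreal_less_iff flip: ennreal_plus)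
  have KU: "K \<in> sets borel" "U \<in> sets borel"
    using K U by (auto intro: borel_compact)
  have "measure M ((U - K) \<inter> S) = measure N (U - K)"
    using N[of "U - K"] KU by (simp add: measure_def)
  also have "\<dots> = measure N U - measure N K"
    using K U KU by (intro N.finite_measure_Diff) (auto simp: N_sets)
  also have "\<dots> < e" using K U' by simp
  finally show ?thesis using K U by blast
qed

text \<open>For an indicator function of \<open>A\<close>, take \<open>K \<subseteq> A \<subseteq> U\<close> with \<open>K\<close> compact, \<open>U\<close> open and
  \<open>U - K\<close> of small measure. A set of small diameter that meets \<open>K\<close> lies in \<open>U\<close>. With
  the constant 1 on sets that meet \<open>K\<close> and 0 on the others, the error is therefore supported in
  \<open>U - K\<close>. The property passes to sums and, since disjointness of the sets bounds the accumulated
  error by an \<open>L\<^sup>1\<close> norm, to \<open>L\<^sup>1\<close> limits.\<close>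
lemma integrable_approx_small_sets:
  fixes S :: "'a::{second_countable_topology, complete_space, heine_borel} set"
    and g :: "'a \<Rightarrow> 'b::{banach, second_countable_topology}"
  assumes "finite_measure M" and M: "sets M = sets (restrict_space borel S)" and S: "S \<in> sets borel"
    and "integrable M g" "0 < e"
  shows "\<exists>\<delta>>0. \<forall>(J :: nat set) I. finite J \<longrightarrow> disjoint_family_on I J \<longrightarrow>
    (\<forall>j\<in>J. I j \<in> sets M \<and> (\<forall>x\<in>I j. \<forall>y\<in>I j. dist x y < \<delta>)) \<longrightarrow>
    (\<exists>c. (\<Sum>j\<in>J. LINT x:I j|M. norm (g x - c j)) < e)"
  using assms(4,5)
proof (induction arbitrary: e)
  case (base A v)
  interpret finite_measure M by fact
  have sp: "space M = S"
    using sets_eq_imp_space_eq[OF M] by (simp add: space_restrict_space)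
  obtain K U where KU: "compact K" "open U" "K \<subseteq> A" "A \<subseteq> U"
      and small: "measure M ((U - K) \<inter> S) < e / (norm v + 1)"
    using finite_measure_regular[OF assms(1-3) base(1), of "e / (norm v + 1)"] base
    by (auto simp: add_nonneg_pos)
  have "closed (- U)" "K \<inter> - U = {}"
    using KU by auto
  then obtain \<delta> where \<delta>: "0 < \<delta>" "\<And>x y. x \<in> K \<Longrightarrow> y \<notin> U \<Longrightarrow> \<delta> \<le> dist x y"
    using separate_compact_closed[OF \<open>compact K\<close>, of "- U"] by auto
  have W: "(U - K) \<inter> S \<in> sets M"
    using borel_open[OF KU(2)] borel_compact[OF KU(1)] unfolding M sets_restrict_space
    by (auto intro!: image_eqI[of _ _ "U - K"])
  show ?case
  proof (intro exI[of _ \<delta>] conjI allI impI \<delta>(1))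
    fix J :: "nat set" and I
    assume J: "finite J" "disjoint_family_on I J"
      and I: "\<forall>j\<in>J. I j \<in> sets M \<and> (\<forall>x\<in>I j. \<forall>y\<in>I j. dist x y < \<delta>)"
    define c where "c j = (if I j \<inter> K = {} then 0 else v)" for j
    have bound: "norm (indicator A x *\<^sub>R v - c j) \<le> norm v * indicator ((U - K) \<inter> S) x"
      if "j \<in> J" "x \<in> I j" for j x
    proof -
      have "x \<in> S" using I that sets.sets_into_space[of "I j" M] by (auto simp: sp)
      have "x \<in> U" if "I j \<inter> K \<noteq> {}"
      proof -
        from that obtain y where "y \<in> I j" "y \<in> K" by auto
        with I \<open>j \<in> J\<close> \<open>x \<in> I j\<close> \<delta>(2)[of y x] show ?thesis by force
      qed
      with KU \<open>x \<in> S\<close> that show ?thesis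
        by (auto simp: c_def indicator_def)
    qed
    have int_ind: "integrable M (\<lambda>x. norm v * indicator ((U - K) \<inter> S) x)"
      using W by (intro integrable_mult_right integrable_real_indicator) (auto simp: less_top[symmetric])
    have int: "integrable M (\<lambda>x. norm (indicator A x *\<^sub>R v - c j))" for j
      using base(1) by (intro integrable_norm Bochner_Integration.integrable_diff integrable_scaleR_left
          integrable_real_indicator) (auto simp: less_top[symmetric])
    have "(\<Sum>j\<in>J. LINT x:I j|M. norm (indicator A x *\<^sub>R v - c j))
        \<le> (\<Sum>j\<in>J. LINT x:I j|M. norm v * indicator ((U - K) \<inter> S) x)"
      using I int int_ind bound unfolding set_lebesgue_integral_def
      by (intro sum_mono integral_mono integrable_mult_indicator) (auto simp: indicator_def)
    also have "\<dots> \<le> (LINT x|M. norm v * indicator ((U - K) \<inter> S) x)"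
      using I J int_ind by (intro sum_set_integral_le) auto
    also have "\<dots> = norm v * measure M ((U - K) \<inter> S)"
      using W sets.sets_into_space[OF W] by (simp add: Int_absorb2)
    also have "\<dots> \<le> norm v * (e / (norm v + 1))"
      using small by (intro mult_left_mono) auto
    also have "\<dots> < e"
      using \<open>0 < e\<close> by (simp add: pos_divide_less_eq add_nonneg_pos distrib_left mult.commute)
    finally show "\<exists>c. (\<Sum>j\<in>J. LINT x:I j|M. norm (indicator A x *\<^sub>R v - c j)) < e" by blast
  qed
next
  case (add f g)
  interpret finite_measure M by fact
  obtain \<delta>1 where \<delta>1: "\<delta>1 > 0" "\<And>(J :: nat set) I. finite J \<Longrightarrow> disjoint_family_on I J \<Longrightarrow>
    (\<forall>j\<in>J. I j \<in> sets M \<and> (\<forall>x\<in>I j. \<forall>y\<in>I j. dist x y < \<delta>1)) \<Longrightarrow>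
    (\<exists>c. (\<Sum>j\<in>J. LINT x:I j|M. norm (f x - c j)) < e/2)"
    using add.IH(1)[of "e/2"] add.prems by auto
  obtain \<delta>2 where \<delta>2: "\<delta>2 > 0" "\<And>(J :: nat set) I. finite J \<Longrightarrow> disjoint_family_on I J \<Longrightarrow>
    (\<forall>j\<in>J. I j \<in> sets M \<and> (\<forall>x\<in>I j. \<forall>y\<in>I j. dist x y < \<delta>2)) \<Longrightarrow>
    (\<exists>c. (\<Sum>j\<in>J. LINT x:I j|M. norm (g x - c j)) < e/2)"
    using add.IH(2)[of "e/2"] add.prems by auto
  show ?case
  proof (intro exI[of _ "min \<delta>1 \<delta>2"] conjI allI impI)
    fix J :: "nat set" and I
    assume J: "finite J" "disjoint_family_on I J"
      and I: "\<forall>j\<in>J. I j \<in> sets M \<and> (\<forall>x\<in>I j. \<forall>y\<in>I j. dist x y < min \<delta>1 \<delta>2)"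
    obtain c1 where c1: "(\<Sum>j\<in>J. LINT x:I j|M. norm (f x - c1 j)) < e/2"
      using \<delta>1(2)[OF J] I by auto
    obtain c2 where c2: "(\<Sum>j\<in>J. LINT x:I j|M. norm (g x - c2 j)) < e/2"
      using \<delta>2(2)[OF J] I by auto
    have int: "set_integrable M (I j) (\<lambda>x. norm (f x - c1 j))" "set_integrable M (I j) (\<lambda>x. norm (g x - c2 j))"
       "set_integrable M (I j) (\<lambda>x. norm (f x + g x - (c1 j + c2 j)))"
      if "j \<in> J" for j
      using I that add.hyps by (auto intro!: integrable_imp_set_integrable)
    have "(\<Sum>j\<in>J. LINT x:I j|M. norm (f x + g x - (c1 j + c2 j))) \<le>
        (\<Sum>j\<in>J. (LINT x:I j|M. norm (f x - c1 j)) + (LINT x:I j|M. norm (g x - c2 j)))"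
    proof (rule sum_mono)
      fix j assume j: "j \<in> J"
      have "(LINT x:I j|M. norm (f x + g x - (c1 j + c2 j))) \<le> (LINT x:I j|M. norm (f x - c1 j) + norm (g x - c2 j))"
        using int[OF j] by (intro set_integral_mono set_integral_add) (auto simp: norm_diff_triangle_ineq)
      then show "(LINT x:I j|M. norm (f x + g x - (c1 j + c2 j))) \<le>
          (LINT x:I j|M. norm (f x - c1 j)) + (LINT x:I j|M. norm (g x - c2 j))"
        using int[OF j] by (simp add: set_integral_add)
    qed
    also have "\<dots> < e" using c1 c2 by (simp add: sum.distrib)
    finally show "\<exists>c. (\<Sum>j\<in>J. LINT x:I j|M. norm (f x + g x - c j)) < e"
      by (intro exI[of _ "\<lambda>j. c1 j + c2 j"])
  qed (use \<delta>1 \<delta>2 in auto)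
next
  case (lim f s)
  interpret finite_measure M by fact
  have [measurable]: "f \<in> borel_measurable M" "s i \<in> borel_measurable M" for i
    using lim.hyps(1,4) by auto
  have "(\<lambda>i. LINT x|M. norm (f x - s i x)) \<longlonglongrightarrow> (LINT x|M. 0)"
  proof (rule integral_dominated_convergence[where w="\<lambda>x. 3 * norm (f x)"])
    show "AE x in M. (\<lambda>i. norm (f x - s i x)) \<longlonglongrightarrow> 0"
    proof (rule AE_I2)
      fix x assume "x \<in> space M"
      from tendsto_diff[OF tendsto_const lim.hyps(2)[OF this], of "f x"]
      show "(\<lambda>i. norm (f x - s i x)) \<longlonglongrightarrow> 0"
        by (intro tendsto_norm_zero) simp
    qed
    show "AE x in M. norm (norm (f x - s i x)) \<le> 3 * norm (f x)" for i
    proof (rule AE_I2)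
      fix x assume "x \<in> space M"
      from lim.hyps(3)[OF this, of i] norm_triangle_ineq4[of "f x" "s i x"]
      show "norm (norm (f x - s i x)) \<le> 3 * norm (f x)" by simp
    qed
  qed (use lim.hyps(4) in auto)
  then have "\<forall>\<^sub>F i in sequentially. (LINT x|M. norm (f x - s i x)) < e/2"
    using lim.prems by (intro order_tendstoD(2)) auto
  then obtain i where i: "(LINT x|M. norm (f x - s i x)) < e/2"
    by (auto simp: eventually_sequentially)
  obtain \<delta> where \<delta>: "\<delta> > 0" "\<And>(J :: nat set) I. finite J \<Longrightarrow> disjoint_family_on I J \<Longrightarrow>
    (\<forall>j\<in>J. I j \<in> sets M \<and> (\<forall>x\<in>I j. \<forall>y\<in>I j. dist x y < \<delta>)) \<Longrightarrow>
    (\<exists>c. (\<Sum>j\<in>J. LINT x:I j|M. norm (s i x - c j)) < e/2)"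
    using lim.IH[of "e/2" i] lim.prems by auto
  show ?case
  proof (intro exI[of _ \<delta>] conjI allI impI \<delta>(1))
    fix J :: "nat set" and I
    assume J: "finite J" "disjoint_family_on I J"
      and I: "\<forall>j\<in>J. I j \<in> sets M \<and> (\<forall>x\<in>I j. \<forall>y\<in>I j. dist x y < \<delta>)"
    obtain c where c: "(\<Sum>j\<in>J. LINT x:I j|M. norm (s i x - c j)) < e/2"
      using \<delta>(2)[OF J I] by auto
    have int: "set_integrable M (I j) (\<lambda>x. norm (s i x - c j))" "set_integrable M (I j) (\<lambda>x. norm (f x - s i x))"
       "set_integrable M (I j) (\<lambda>x. norm (f x - c j))"
      if "j \<in> J" for j
      using I that lim.hyps(1,4) by (auto intro!: integrable_imp_set_integrable)
    have "(\<Sum>j\<in>J. LINT x:I j|M. norm (f x - c j)) \<le>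
        (\<Sum>j\<in>J. (LINT x:I j|M. norm (f x - s i x)) + (LINT x:I j|M. norm (s i x - c j)))"
    proof (rule sum_mono)
      fix j assume j: "j \<in> J"
      have "(LINT x:I j|M. norm (f x - c j)) \<le> (LINT x:I j|M. norm (f x - s i x) + norm (s i x - c j))"
        using int[OF j] by (intro set_integral_mono set_integral_add) (auto intro: norm_diff_triangle_le[OF order_refl order_refl])
      then show "(LINT x:I j|M. norm (f x - c j)) \<le>
          (LINT x:I j|M. norm (f x - s i x)) + (LINT x:I j|M. norm (s i x - c j))"
        using int[OF j] by (simp add: set_integral_add)
    qed
    also have "\<dots> = (\<Sum>j\<in>J. LINT x:I j|M. norm (f x - s i x)) + (\<Sum>j\<in>J. LINT x:I j|M. norm (s i x - c j))"
      by (rule sum.distrib)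
    also have "(\<Sum>j\<in>J. LINT x:I j|M. norm (f x - s i x)) \<le> (LINT x|M. norm (f x - s i x))"
      using lim.hyps(1,4) I J by (intro sum_set_integral_le) auto
    finally show "\<exists>c. (\<Sum>j\<in>J. LINT x:I j|M. norm (f x - c j)) < e"
      using c i by (intro exI[of _ c]) simp
  qed
qed

section \<open>Estimates for parametric integrands\<close>

lemma parametric_integrand_scaleR:
  "parametric_integrand C F \<Longrightarrow> x \<in> C \<Longrightarrow> 0 \<le> K \<Longrightarrow> F x (K *\<^sub>R t) = K * F x t"
  by (simp add: parametric_integrand_def)

lemma parametric_integrand_linear_bound:
  fixes C :: "'a::euclidean_space set"
  assumes F: "parametric_integrand C F" and C: "compact C"
  obtains B where "0 < B" "\<And>x t. x \<in> C \<Longrightarrow> \<bar>F x t\<bar> \<le> B * norm t"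
proof -
  have "continuous_on (C \<times> cball 0 1) (\<lambda>(x, t). F x t)"
    using F by (auto simp: parametric_integrand_def intro: continuous_on_subset)
  then have "bounded ((\<lambda>(x, t). F x t) ` (C \<times> cball 0 1))"
    by (intro compact_imp_bounded compact_continuous_image compact_Times C compact_cball)
  then obtain B where B_pos: "0 < B" and B_all: "\<forall>p\<in>C \<times> cball 0 1. \<bar>case p of (x, t) \<Rightarrow> F x t\<bar> \<le> B"
    unfolding bounded_pos by auto
  have B: "\<bar>F x t\<bar> \<le> B" if "x \<in> C" "norm t \<le> 1" for x t
    using B_all[rule_format, of "(x, t)"] that by simp
  have "\<bar>F x t\<bar> \<le> B * norm t" if x: "x \<in> C" for x t
  proof (cases "t = 0")
    case False
    have "F x t = norm t * F x (t /\<^sub>R norm t)"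
      using parametric_integrand_scaleR[OF F x, of "norm t" "t /\<^sub>R norm t"] False by simp
    moreover have "\<bar>F x (t /\<^sub>R norm t)\<bar> \<le> B"
      using False by (intro B x) auto
    ultimately show ?thesis
      by (simp add: abs_mult mult.commute[of B] mult_left_mono)
  qed (use parametric_integrand_scaleR[OF F x, of 0 0] in simp)
  with B_pos that show thesis by blast
qed

text \<open>After scaling \<open>s\<close> and \<open>t\<close> by \<open>R = norm s + norm t\<close> they lie in the unit ball, where \<open>F\<close> is
  uniformly continuous. If the scaled vectors are close, the first summand is the bound; if they are not,
  \<open>norm (s - t)\<close> is at least a fixed multiple of \<open>R\<close>, and the linear growth of \<open>F\<close> gives the second
  summand.\<close>
lemma parametric_integrand_modulus:
  fixes C :: "'a::euclidean_space set"
  assumes F: "parametric_integrand C F" and C: "compact C" and "0 < e"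
  obtains K \<delta> where "0 < K" "0 < \<delta>"
    "\<And>x y s t. x \<in> C \<Longrightarrow> y \<in> C \<Longrightarrow> dist x y < \<delta> \<Longrightarrow>
      \<bar>F x s - F y t\<bar> \<le> e * (norm s + norm t) + K * norm (s - t)"
proof -
  obtain B where B: "0 < B" "\<And>x t. x \<in> C \<Longrightarrow> \<bar>F x t\<bar> \<le> B * norm t"
    using parametric_integrand_linear_bound[OF F C] by blast
  have "continuous_on (C \<times> cball 0 1) (\<lambda>(x, t). F x t)"
    using F by (auto simp: parametric_integrand_def intro: continuous_on_subset)
  then have "uniformly_continuous_on (C \<times> cball 0 1) (\<lambda>(x, t). F x t)"
    by (intro compact_uniformly_continuous compact_Times C compact_cball)
  then obtain d where d: "0 < d" and d_all: "\<forall>p\<in>C \<times> cball 0 1. \<forall>q\<in>C \<times> cball 0 1.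
      dist q p < d \<longrightarrow> dist (case q of (x, t) \<Rightarrow> F x t) (case p of (x, t) \<Rightarrow> F x t) < e"
    unfolding uniformly_continuous_on_def using \<open>0 < e\<close> by meson
  have close: "\<bar>F x u - F y v\<bar> < e"
    if "x \<in> C" "y \<in> C" "norm u \<le> 1" "norm v \<le> 1" "dist (x, u) (y, v) < d" for x y u v
    using d_all[rule_format, of "(y, v)" "(x, u)"] that by (simp add: dist_real_def)
  show thesis
  proof (rule that[of "2 * B / (d/2)" "d/2"])
    fix x y s t :: 'a assume xy: "x \<in> C" "y \<in> C" "dist x y < d/2"
    define R where "R = norm s + norm t"
    have R: "0 \<le> R" "norm s \<le> R" "norm t \<le> R" by (simp_all add: R_def)
    show "\<bar>F x s - F y t\<bar> \<le> e * (norm s + norm t) + 2 * B / (d/2) * norm (s - t)"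
    proof (cases "norm (s - t) < d/2 * R")
      case True
      then have "0 < R"
        using R d norm_ge_zero[of "s - t"] by (cases "R = 0") auto
      have hom: "F x s = R * F x (s /\<^sub>R R)" "F y t = R * F y (t /\<^sub>R R)"
        using parametric_integrand_scaleR[OF F xy(1), of R "s /\<^sub>R R"]
          parametric_integrand_scaleR[OF F xy(2), of R "t /\<^sub>R R"] \<open>0 < R\<close> by simp_all
      have "dist (s /\<^sub>R R) (t /\<^sub>R R) = norm (s - t) / R"
        using \<open>0 < R\<close> by (simp add: dist_norm flip: scaleR_diff_right) (simp add: field_simps)
      also have "\<dots> < d/2" using True \<open>0 < R\<close> by (simp add: field_simps)
      finally have "dist (x, s /\<^sub>R R) (y, t /\<^sub>R R) < d"
        using xy sqrt_sum_squares_le_sum[of "dist x y" "dist (s /\<^sub>R R) (t /\<^sub>R R)"]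
        by (simp add: dist_Pair_Pair)
      moreover have "norm (s /\<^sub>R R) \<le> 1" "norm (t /\<^sub>R R) \<le> 1"
        using R \<open>0 < R\<close> by (simp_all add: inverse_eq_divide)
      ultimately have "\<bar>F x (s /\<^sub>R R) - F y (t /\<^sub>R R)\<bar> \<le> e"
        using xy by (intro less_imp_le[OF close])
      then have "R * \<bar>F x (s /\<^sub>R R) - F y (t /\<^sub>R R)\<bar> \<le> R * e"
        using R by (intro mult_left_mono) auto
      moreover have "R * \<bar>F x (s /\<^sub>R R) - F y (t /\<^sub>R R)\<bar> = \<bar>F x s - F y t\<bar>"
        unfolding hom right_diff_distrib[symmetric] using R by (simp add: abs_mult)
      moreover have "0 \<le> 2 * B / (d/2) * norm (s - t)"
        using B d by simp
      ultimately show ?thesis by (simp add: R_def mult.commute)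
    next
      case False
      have "\<bar>F x s - F y t\<bar> \<le> B * norm s + B * norm t"
        using B(2)[OF xy(1), of s] B(2)[OF xy(2), of t] by linarith
      also have "\<dots> = 2 * B / (d/2) * (d/2 * R) / 2"
        using d by (simp add: R_def field_simps)
      also have "\<dots> \<le> 2 * B / (d/2) * (d/2 * R)"
        using d B(1) R by simp
      also have "\<dots> \<le> 2 * B / (d/2) * norm (s - t)"
        using False B d by (intro mult_left_mono) auto
      finally show ?thesis
        using mult_nonneg_nonneg[OF less_imp_le[OF \<open>0 < e\<close>] R(1)] by (simp add: R_def)
    qed
  qed (use B d in auto)
qed

context finite_measure
begin

lemma set_integrable_const: "A \<in> sets M \<Longrightarrow> set_integrable M A (\<lambda>_. c)"
  for c :: "'b::{banach, second_countable_topology}"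
  by (intro integrable_imp_set_integrable integrable_const)

lemma set_integral_const: "A \<in> sets M \<Longrightarrow> (LINT x:A|M. c) = measure M A *\<^sub>R c"
  for c :: "'b::{banach, second_countable_topology}"
  by (auto simp: set_lebesgue_integral_def less_top[symmetric])

end

text \<open>With \<open>m = measure M I\<close>, both terms are compared with \<open>F y (m *\<^sub>R c) = m * F y c\<close>. The
  auxiliary vector \<open>c\<close> itself is controlled through \<open>m * norm c \<le> \<integral>\<^bsub>I\<^esub> norm \<theta> + \<integral>\<^bsub>I\<^esub> norm (\<theta> - c)\<close>.
  Working with \<open>m *\<^sub>R c\<close> instead of the mean value of \<open>\<theta>\<close> avoids a division by \<open>m\<close>, which may be 0.\<close>
lemma integrand_local_estimate:
  fixes \<theta> :: "'x \<Rightarrow> 'a::euclidean_space"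
  assumes "finite_measure M" and F: "parametric_integrand C F" and y: "y \<in> C"
    and I: "I \<in> sets M" and \<theta>: "set_integrable M I \<theta>"
    and int: "set_integrable M I (\<lambda>x. F (f x) (\<theta> x))"
    and "0 < e" "0 < K"
    and mod: "\<And>x s t. x \<in> I \<Longrightarrow> \<bar>F y s - F (f x) t\<bar> \<le> e * (norm s + norm t) + K * norm (s - t)"
    and mod': "\<And>s t. \<bar>F y s - F y t\<bar> \<le> e * (norm s + norm t) + K * norm (s - t)"
  shows "\<bar>F y (LINT x:I|M. \<theta> x) - (LINT x:I|M. F (f x) (\<theta> x))\<bar> \<le>
    4 * e * (LINT x:I|M. norm (\<theta> x)) + 2 * (e + K) * (LINT x:I|M. norm (\<theta> x - c))"
proof -
  interpret finite_measure M by fact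
  define m t T E where "m = measure M I" and "t = (LINT x:I|M. \<theta> x)"
    and "T = (LINT x:I|M. norm (\<theta> x))" and "E = (LINT x:I|M. norm (\<theta> x - c))"
  note const = set_integrable_const[OF I] and const_eq = set_integral_const[OF I, folded m_def]
  have nint: "set_integrable M I (\<lambda>x. norm (\<theta> x))" "set_integrable M I (\<lambda>x. norm (\<theta> x - c))"
    using \<theta> const[of c] by (auto intro!: set_integrable_norm set_integral_diff)
  have "t - m *\<^sub>R c = (LINT x:I|M. \<theta> x - c)"
    using \<theta> const[of c] by (simp add: t_def const_eq set_integral_diff)
  also have "norm \<dots> \<le> E"
    unfolding E_def using \<theta> const[of c] by (intro set_integral_norm_bound set_integral_diff)
  finally have 1: "norm (t - m *\<^sub>R c) \<le> E" .
  have 2: "norm t \<le> T"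
    unfolding t_def T_def using \<theta> by (rule set_integral_norm_bound)
  have m: "0 \<le> m" by (simp add: m_def)
  have 3: "m * norm c \<le> T + E"
  proof -
    have "m * norm c = norm (t - (t - m *\<^sub>R c))" using m by simp
    also have "\<dots> \<le> norm t + norm (t - m *\<^sub>R c)" by (rule norm_triangle_ineq4)
    finally show ?thesis using 1 2 by simp
  qed
  have hom: "F y (m *\<^sub>R c) = m * F y c"
    using F y m by (rule parametric_integrand_scaleR)
  have 4: "\<bar>F y t - m * F y c\<bar> \<le> e * (T + (T + E)) + K * E"
  proof -
    have "\<bar>F y t - m * F y c\<bar> \<le> e * (norm t + norm (m *\<^sub>R c)) + K * norm (t - m *\<^sub>R c)"
      unfolding hom[symmetric] by (rule mod')
    also have "\<dots> \<le> e * (T + (T + E)) + K * E"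
      using 1 2 3 m \<open>0 < e\<close> \<open>0 < K\<close> by (intro add_mono mult_left_mono) auto
    finally show ?thesis .
  qed
  have "m * F y c - (LINT x:I|M. F (f x) (\<theta> x)) = (LINT x:I|M. F y c - F (f x) (\<theta> x))"
    using int const[of "F y c"] by (simp add: const_eq set_integral_diff)
  also have "\<bar>\<dots>\<bar> \<le> (LINT x:I|M. \<bar>F y c - F (f x) (\<theta> x)\<bar>)"
    using set_integral_norm_bound[of M I "\<lambda>x. F y c - F (f x) (\<theta> x)"] int const[of "F y c"]
    by (simp add: set_integral_diff)
  also have "\<dots> \<le> (LINT x:I|M. e * norm c + e * norm (\<theta> x) + K * norm (\<theta> x - c))"
  proof (rule set_integral_mono)
    show "set_integrable M I (\<lambda>x. \<bar>F y c - F (f x) (\<theta> x)\<bar>)"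
      using int const[of "F y c"] by (intro set_integrable_abs set_integral_diff)
    show "set_integrable M I (\<lambda>x. e * norm c + e * norm (\<theta> x) + K * norm (\<theta> x - c))"
      using nint const by (intro set_integral_add set_integrable_mult_right) auto
    show "\<bar>F y c - F (f x) (\<theta> x)\<bar> \<le> e * norm c + e * norm (\<theta> x) + K * norm (\<theta> x - c)" if "x \<in> I" for x
      using mod[OF that, of c "\<theta> x"] by (simp add: distrib_left norm_minus_commute)
  qed
  also have "\<dots> = e * (m * norm c) + e * T + K * E"
    using nint const[of "e * norm c"]
    by (simp add: set_integral_add set_integrable_mult_right const_eq T_def E_def)
  also have "\<dots> \<le> e * (T + E) + e * T + K * E"
    using 3 \<open>0 < e\<close> by simp
  finally have "\<bar>m * F y c - (LINT x:I|M. F (f x) (\<theta> x))\<bar> \<le> e * (T + E) + e * T + K * E" .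
  with 4 show ?thesis
    unfolding t_def[symmetric] T_def[symmetric] E_def[symmetric] by (simp add: algebra_simps)
qed

section \<open>Convergence of the Riemann sums\<close>

theorem mainTheorem2:
  fixes f :: "real \<Rightarrow> real ^ 'm"
    and F :: "real ^ 'm \<Rightarrow> real ^ 'm \<Rightarrow> real"
    and \<theta> :: "real \<Rightarrow> real ^ 'm"
    and a b :: real
  assumes "a < b"
    and "continuous_on {a..b} f"
    and "rectifiable f a b"
    and "parametric_integrand (f ` {a..b}) F"
    and "\<And>m. signed_RN_derivative (curve_measure f a b)
                (signed_variation_measure (\<lambda>x. f x $ m) a b) (\<lambda>x. \<theta> x $ m)"
  shows "integrable (curve_measure f a b) (\<lambda>x. F (f x) (\<theta> x)) \<and>
    (\<forall>\<epsilon>>0. \<exists>\<delta>>0. \<forall>n x \<xi>.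
       interval_partition a b n x \<and> mesh n x < \<delta> \<and> (\<forall>i<n. \<xi> i \<in> {x i..x (Suc i)}) \<longrightarrow>
       \<bar>(\<Sum>i<n. F (f (\<xi> i)) (f (x (Suc i)) - f (x i)))
          - (LINT x|curve_measure f a b. F (f x) (\<theta> x))\<bar> < \<epsilon>)"
proof -
  define M where "M = curve_measure f a b"
  define C where "C = f ` {a..b}"
  have ab: "a \<le> b" using assms(1) by simp
  have sets_M: "sets M = sets (restrict_space borel {a..b})"
    unfolding M_def by (rule sets_curve_measure[OF ab assms(2,3)])
  have sp: "space M = {a..b}"
    using sets_eq_imp_space_eq[OF sets_M] by (simp add: space_restrict_space)
  have M_Icc: "emeasure M {c..d} = curve_length f c d" if "a \<le> c" "c \<le> d" "d \<le> b" for c d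
    unfolding M_def using emeasure_curve_measure[OF ab assms(2,3)] that .
  have sub: "A \<in> sets M" if "A \<in> sets borel" "A \<subseteq> {a..b}" for A
    using that unfolding sets_M sets_restrict_space by (auto intro!: image_eqI[of _ _ A])
  interpret finite_measure M
    using assms(3) ab by (intro finite_measureI) (auto simp: sp M_Icc rectifiable_def)
  have C: "compact C"
    unfolding C_def using assms(2) by (intro compact_continuous_image) auto
  have F: "parametric_integrand C F"
    unfolding C_def by fact
  have \<theta>m: "integrable M (\<lambda>x. \<theta> x $ m)"
    and \<theta>m_eq: "A \<in> sets M \<Longrightarrow> (LINT x:A|M. \<theta> x $ m) = signed_variation_measure (\<lambda>x. f x $ m) a b A" for m A
    using assms(5)[of m] by (auto simp: signed_RN_derivative_def M_def)
  have \<theta>: "integrable M \<theta>"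
  proof -
    have "integrable M (\<lambda>x. \<Sum>k\<in>Basis. (\<theta> x \<bullet> k) *\<^sub>R k)"
      using \<theta>m by (intro Bochner_Integration.integrable_sum integrable_scaleR_left)
        (auto simp: Basis_vec_def inner_axis)
    then show ?thesis by (simp add: euclidean_representation)
  qed
  then have \<theta>_set: "set_integrable M A \<theta>" if "A \<in> sets M" for A
    using that by (intro integrable_imp_set_integrable)
  have Icc: "(LINT x:{c..d}|M. \<theta> x) = f d - f c" if cd: "a \<le> c" "c \<le> d" "d \<le> b" for c d
  proof (rule vec_eq_iff[THEN iffD2], rule allI)
    fix m
    have A: "{c..d} \<in> sets M" using cd by (intro sub) auto
    have "(LINT x:{c..d}|M. \<theta> x) $ m = (LINT x:{c..d}|M. \<theta> x $ m)"
      using integral_bounded_linear[OF bounded_linear_vec_nth \<theta>_set[OF A, unfolded set_integrable_def], of m]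
      by (simp add: set_lebesgue_integral_def)
    also have "\<dots> = f d $ m - f c $ m"
      unfolding \<theta>m_eq[OF A] using component_le_norm_cart[of "f _ - f _" m]
      by (intro signed_variation_measure_Icc[OF ab assms(2,3) _ cd]) auto
    finally show "(LINT x:{c..d}|M. \<theta> x) $ m = (f d - f c) $ m" by simp
  qed
  (* Half-open intervals are disjoint; the left endpoint carries no integral, by the closed case with
     c = d. *)
  have Ioc: "(LINT x:{c<..d}|M. \<theta> x) = f d - f c" if cd: "a \<le> c" "c \<le> d" "d \<le> b" for c d
  proof -
    have "{c..d} = {c..c} \<union> {c<..d}" using cd by auto
    moreover have "(LINT x:{c..c} \<union> {c<..d}|M. \<theta> x) = (LINT x:{c..c}|M. \<theta> x) + (LINT x:{c<..d}|M. \<theta> x)"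
      using cd by (intro set_integral_Un \<theta>_set sub) auto
    ultimately show ?thesis using Icc[OF cd] Icc[of c c] cd by simp
  qed
  obtain B where B: "0 < B" "\<And>x t. x \<in> C \<Longrightarrow> \<bar>F x t\<bar> \<le> B * norm t"
    using parametric_integrand_linear_bound[OF F C] by blast
  have int: "integrable M (\<lambda>x. F (f x) (\<theta> x))"
  proof (rule Bochner_Integration.integrable_bound)
    show "integrable M (\<lambda>x. B * norm (\<theta> x))" using \<theta> by auto
    have f: "f \<in> borel_measurable M"
      unfolding measurable_cong_sets[OF sets_M refl]
      by (rule borel_measurable_continuous_on_restrict) fact
    have "(\<lambda>x. (f x, \<theta> x)) \<in> measurable M (restrict_space borel (C \<times> UNIV))"
      using f \<theta> by (intro measurable_restrict_space2 borel_measurable_Pair) (auto simp: sp C_def)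
    moreover have "(\<lambda>(x, t). F x t) \<in> borel_measurable (restrict_space borel (C \<times> UNIV))"
      using F by (intro borel_measurable_continuous_on_restrict) (simp add: parametric_integrand_def)
    ultimately have "(\<lambda>x. case (f x, \<theta> x) of (x, t) \<Rightarrow> F x t) \<in> borel_measurable M"
      by (rule measurable_compose)
    then show "(\<lambda>x. F (f x) (\<theta> x)) \<in> borel_measurable M" by simp
    show "AE x in M. norm (F (f x) (\<theta> x)) \<le> norm (B * norm (\<theta> x))"
      using B by (intro AE_I2) (auto simp: sp C_def abs_mult)
  qed
  then have int_set: "set_integrable M A (\<lambda>x. F (f x) (\<theta> x))" if "A \<in> sets M" for A
    using that by (intro integrable_imp_set_integrable)
  have "\<exists>\<delta>>0. \<forall>n x \<xi>.
       interval_partition a b n x \<and> mesh n x < \<delta> \<and> (\<forall>i<n. \<xi> i \<in> {x i..x (Suc i)}) \<longrightarrow>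
       \<bar>(\<Sum>i<n. F (f (\<xi> i)) (f (x (Suc i)) - f (x i))) - (LINT x|M. F (f x) (\<theta> x))\<bar> < \<epsilon>"
    if "\<epsilon> > 0" for \<epsilon> :: real
  proof -
    define L where "L = (LINT x|M. norm (\<theta> x))"
    have "0 \<le> L" by (simp add: L_def)
    define e where "e = \<epsilon> / (2 * (4 * L + 1))"
    have e: "0 < e" "4 * e * L < \<epsilon> / 2"
      using \<open>\<epsilon> > 0\<close> \<open>0 \<le> L\<close> by (simp_all add: e_def field_simps)
    (* The total error is bounded by 4 e L + 2 (e + K) eta, where L is the integral of norm theta. As K
       depends on e, the tolerance eta for the approximation in mean is chosen last. *)
    obtain K \<delta>F where K: "0 < K" "0 < \<delta>F"
      and mod: "\<And>x y s t. x \<in> C \<Longrightarrow> y \<in> C \<Longrightarrow> dist x y < \<delta>F \<Longrightarrow>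
        \<bar>F x s - F y t\<bar> \<le> e * (norm s + norm t) + K * norm (s - t)"
      using parametric_integrand_modulus[OF F C e(1)] by blast
    define \<eta> where "\<eta> = \<epsilon> / (4 * (e + K))"
    have \<eta>: "0 < \<eta>" "2 * (e + K) * \<eta> = \<epsilon> / 2"
      using \<open>\<epsilon> > 0\<close> e K by (simp_all add: \<eta>_def field_simps)
    obtain \<delta>1 where \<delta>1: "\<delta>1 > 0" "\<And>(J :: nat set) I. finite J \<Longrightarrow> disjoint_family_on I J \<Longrightarrow>
        (\<forall>j\<in>J. I j \<in> sets M \<and> (\<forall>x\<in>I j. \<forall>y\<in>I j. dist x y < \<delta>1)) \<Longrightarrow>
        (\<exists>c. (\<Sum>j\<in>J. LINT x:I j|M. norm (\<theta> x - c j)) < \<eta>)"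
      using integrable_approx_small_sets[OF finite_measure_axioms sets_M _ \<theta> \<eta>(1)] by auto
    have "uniformly_continuous_on {a..b} f"
      using assms(2) by (intro compact_uniformly_continuous) auto
    then obtain \<delta>2 where \<delta>2: "\<delta>2 > 0"
      "\<And>x y. x \<in> {a..b} \<Longrightarrow> y \<in> {a..b} \<Longrightarrow> dist x y < \<delta>2 \<Longrightarrow> dist (f x) (f y) < \<delta>F"
      unfolding uniformly_continuous_on_def using K by (metis dist_commute)
    show ?thesis
    proof (intro exI[of _ "min \<delta>1 \<delta>2"] conjI allI impI; (elim conjE)?)
      fix n x \<xi>
      assume P: "interval_partition a b n x" and mesh: "mesh n x < min \<delta>1 \<delta>2"
        and \<xi>: "\<forall>i<n. \<xi> i \<in> {x i..x (Suc i)}"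
      define I where "I i = {x i<..x (Suc i)}" for i
      have step: "x (Suc i) - x i < min \<delta>1 \<delta>2" if "i < n" for i
        using mesh that unfolding mesh_def by (intro le_less_trans[OF Max_ge mesh[unfolded mesh_def]]) auto
      have bnd: "a \<le> x i" "x i \<le> x (Suc i)" "x (Suc i) \<le> b" if "i < n" for i
        using interval_partition_bounds[OF P] interval_partition_le[OF P, of i "Suc i"] that by auto
      have I_sub: "I i \<subseteq> {a..b}" if "i < n" for i
        using bnd[OF that] by (auto simp: I_def)
      have I_sets: "I i \<in> sets M" if "i < n" for i
        using I_sub[OF that] by (intro sub) (auto simp: I_def)
      have disj: "disjoint_family_on I {..<n}"
        unfolding disjoint_family_on_def
      proof (intro ballI impI)
        have "I i \<inter> I j = {}" if "i < j" "j < n" for i j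
          using interval_partition_le[OF P, of "Suc i" j] that by (auto simp: I_def)
        then show "I i \<inter> I j = {}" if "i \<in> {..<n}" "j \<in> {..<n}" "i \<noteq> j" for i j
          using that by (metis Int_commute lessThan_iff nat_neq_iff)
      qed
      obtain c where c: "(\<Sum>j<n. LINT x:I j|M. norm (\<theta> x - c j)) < \<eta>"
      proof -
        have "dist u v < \<delta>1" if "i < n" "u \<in> I i" "v \<in> I i" for i u v
          using step[OF that(1)] that(2,3) by (auto simp: I_def dist_real_def)
        then show ?thesis using \<delta>1(2)[of "{..<n}" I] disj I_sets that by auto
      qed
      have whole: "(LINT x|M. F (f x) (\<theta> x)) = (\<Sum>i<n. LINT x:I i|M. F (f x) (\<theta> x))"
      proof -
        have Un: "(\<Union>i<k. I i) = {a<..x k}" if "k \<le> n" for k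
          using that
        proof (induction k)
          case 0
          then show ?case using P by (auto simp: interval_partition_def)
        next
          case (Suc k)
          then show ?case using bnd[of k] by (auto simp: lessThan_Suc I_def)
        qed
        have "emeasure M {a..a} = 0"
          using ab by (simp only: M_Icc) (simp add: curve_length_eq_variation)
        then have "{a} \<in> null_sets M"
          using ab by (auto intro!: null_setsI sub)
        then have "AE x in M. x \<notin> {a}" by (rule AE_not_in)
        then have "AE x in M. F (f x) (\<theta> x) = indicator {a<..b} x *\<^sub>R F (f x) (\<theta> x)"
          using AE_space by eventually_elim (auto simp: sp)
        moreover have "(\<lambda>x. indicator {a<..b} x *\<^sub>R F (f x) (\<theta> x)) \<in> borel_measurable M"
          by (intro borel_measurable_integrable int_set[unfolded set_integrable_def] sub) auto
        ultimately have "(LINT x|M. F (f x) (\<theta> x)) = (LINT x:{a<..b}|M. F (f x) (\<theta> x))"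
          unfolding set_lebesgue_integral_def
          by (intro integral_cong_AE borel_measurable_integrable[OF int])
        also have "{a<..b} = (\<Union>i<n. I i)"
          using Un[of n] P by (simp add: interval_partition_def)
        also have "(LINT x:(\<Union>i<n. I i)|M. F (f x) (\<theta> x)) = (\<Sum>i<n. LINT x:I i|M. F (f x) (\<theta> x))"
          using disj I_sets int_set by (intro set_integral_finite_Union) auto
        finally show ?thesis .
      qed
      have local: "\<bar>F (f (\<xi> i)) (f (x (Suc i)) - f (x i)) - (LINT x:I i|M. F (f x) (\<theta> x))\<bar> \<le>
          4 * e * (LINT x:I i|M. norm (\<theta> x)) + 2 * (e + K) * (LINT x:I i|M. norm (\<theta> x - c i))"
        if i: "i < n" for i
      proof -
        have \<xi>i: "\<xi> i \<in> {a..b}" using \<xi>[rule_format, OF i] bnd[OF i] by simp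
        have "dist (f (\<xi> i)) (f z) < \<delta>F" if "z \<in> I i" for z
        proof (rule \<delta>2(2)[OF \<xi>i])
          show "z \<in> {a..b}" using that I_sub[OF i] by blast
          show "dist (\<xi> i) z < \<delta>2"
            using that step[OF i] \<xi>[rule_format, OF i] by (auto simp: I_def dist_real_def)
        qed
        then show ?thesis
          unfolding Ioc[OF bnd[OF i], symmetric] I_def[symmetric]
          using \<xi>i I_sub[OF i] I_sets[OF i] e K
          by (intro integrand_local_estimate[OF finite_measure_axioms F] mod \<theta>_set int_set)
            (auto simp: C_def)
      qed
      have "\<bar>(\<Sum>i<n. F (f (\<xi> i)) (f (x (Suc i)) - f (x i))) - (LINT x|M. F (f x) (\<theta> x))\<bar> \<le>
          (\<Sum>i<n. \<bar>F (f (\<xi> i)) (f (x (Suc i)) - f (x i)) - (LINT x:I i|M. F (f x) (\<theta> x))\<bar>)"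
        unfolding whole sum_subtractf[symmetric] by (rule sum_abs)
      also have "\<dots> \<le> (\<Sum>i<n. 4 * e * (LINT x:I i|M. norm (\<theta> x)) + 2 * (e + K) * (LINT x:I i|M. norm (\<theta> x - c i)))"
        by (intro sum_mono local) auto
      also have "\<dots> = 4 * e * (\<Sum>i<n. LINT x:I i|M. norm (\<theta> x))
          + 2 * (e + K) * (\<Sum>i<n. LINT x:I i|M. norm (\<theta> x - c i))"
        by (simp add: sum.distrib sum_distrib_left)
      also have "\<dots> \<le> 4 * e * L + 2 * (e + K) * \<eta>"
        using e K c \<theta> disj I_sets unfolding L_def
        by (intro add_mono mult_left_mono sum_set_integral_le) auto
      also have "\<dots> < \<epsilon>" using e \<eta> by simp
      finally show "\<bar>(\<Sum>i<n. F (f (\<xi> i)) (f (x (Suc i)) - f (x i))) - (LINT x|M. F (f x) (\<theta> x))\<bar> < \<epsilon>" .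
    qed (use \<delta>1 \<delta>2 in auto)
  qed
  with int show ?thesis unfolding M_def by blast
qed

end
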